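(* Let $K$ be a compact Hausdorff topological space and let $Y$ be a Banach space over $\mathbb{K}$. Let $f,g\in C(K,Y)$ be such that $\mathcal{M}_f$ is connected. Then $$f\perp_B g\iff \forall\mu\in\mathbb{T}\ \exists t\in\mathcal{M}_f\text{ such that } f(t)\perp_\mu g(t).$$ In the real case ($\mathbb{K}=\mathbb{R}$), moreover, $$f\perp_B g\iff\exists t\in\mathcal{M}_f\text{ such that } f(t)\perp_B g(t).$$
   Context: $\mathbb{K}$ is $\mathbb{R}$ or $\mathbb{C}$, $\mathbb{T}$ is the set of modulus-one scalars of $\mathbb{K}$. $C(K,Y)$ is the Banach space of continuous functions from $K$ to $Y$ with the supremum norm, and $\mathcal{M}_f=\{t\in K\colon\|f(t)\|=\|f\|\}$ is the norm attainment set of $f$. In a Banach space, $x\perp_B y$ (Birkhoff-James orthogonality) means $\|x+\lambda y\|\geq\|x\|$ for all $\lambda\in\mathbb{K}$; for $\gamma\in\mathbb{T}$, $x\perp_\gamma y$ ($x$ is orthogonal to $y$ in the direction of $\gamma$) means $\|x+t\gamma y\|\geq\|x\|$ for all $t\in\mathbb{R}$. *)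

theory Defs
  imports "HOL-Analysis.Analysis"
begin

(* The distribution has no complex normed spaces: class banach is for real scalars only.
   A complex normed space is taken here as a real one whose scalar multiplication extends to the
   complex numbers. The unit law for scaleC follows from scaleC_of_real. *)

class complex_normed_vector = real_normed_vector +
  fixes scaleC :: "complex \<Rightarrow> 'a \<Rightarrow> 'a" (infixr "*\<^sub>C" 75)
  assumes scaleC_add_right: "c *\<^sub>C (x + y) = c *\<^sub>C x + c *\<^sub>C y"
    and scaleC_add_left: "(c + d) *\<^sub>C x = c *\<^sub>C x + d *\<^sub>C x"
    and scaleC_scaleC: "c *\<^sub>C d *\<^sub>C x = (c * d) *\<^sub>C x"
    and scaleC_of_real: "complex_of_real r *\<^sub>C x = r *\<^sub>R x"
    and norm_scaleC: "norm (c *\<^sub>C x) = cmod c * norm x"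

class complex_banach = complex_normed_vector + banach

instantiation complex :: complex_banach
begin

definition scaleC_complex :: "complex \<Rightarrow> complex \<Rightarrow> complex"
  where "scaleC_complex c x = c * x"

instance
  by standard (simp_all add: scaleC_complex_def algebra_simps norm_mult scaleR_conv_of_real)

end

lemma bounded_linear_scaleC: "bounded_linear (\<lambda>x :: 'a::complex_normed_vector. c *\<^sub>C x)"
proof (rule bounded_linear_intro[where K = "cmod c"])
  fix r and x y :: 'a
  show "c *\<^sub>C (x + y) = c *\<^sub>C x + c *\<^sub>C y"
    by (rule scaleC_add_right)
  show "c *\<^sub>C r *\<^sub>R x = r *\<^sub>R c *\<^sub>C x"
    by (metis scaleC_of_real scaleC_scaleC mult.commute)
  show "norm (c *\<^sub>C x) \<le> norm x * cmod c"
    by (simp add: norm_scaleC)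
qed

(* For compact K, the type of bounded continuous functions from K to Y is C(K,Y); its library norm
   is the supremum norm. *)

instantiation bcontfun :: (topological_space, complex_normed_vector) complex_normed_vector
begin

definition scaleC_bcontfun :: "complex \<Rightarrow> ('a \<Rightarrow>\<^sub>C 'b) \<Rightarrow> 'a \<Rightarrow>\<^sub>C 'b"
  where "scaleC_bcontfun c f = Bcontfun (\<lambda>t. c *\<^sub>C f t)"

lemma scaleC_bcontfun_apply [simp]: "(c *\<^sub>C f) t = c *\<^sub>C f t"
  for f :: "'a \<Rightarrow>\<^sub>C 'b"
proof -
  have "(\<lambda>t. c *\<^sub>C f t) \<in> bcontfun"
    by (rule bcontfun_normI[where b = "cmod c * norm f"])
      (auto intro!: bounded_linear.continuous_on[OF bounded_linear_scaleC] mult_left_mono norm_bounded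
        simp: norm_scaleC)
  then show ?thesis
    by (simp add: scaleC_bcontfun_def Bcontfun_inverse)
qed

instance
proof
  fix c d :: complex and r :: real and f g :: "'a \<Rightarrow>\<^sub>C 'b"
  show "c *\<^sub>C (f + g) = c *\<^sub>C f + c *\<^sub>C g"
    by (rule bcontfun_eqI) (simp add: scaleC_add_right)
  show "(c + d) *\<^sub>C f = c *\<^sub>C f + d *\<^sub>C f"
    by (rule bcontfun_eqI) (simp add: scaleC_add_left)
  show assoc: "c *\<^sub>C d *\<^sub>C f = (c * d) *\<^sub>C f" for c d and f :: "'a \<Rightarrow>\<^sub>C 'b"
    by (rule bcontfun_eqI) (simp add: scaleC_scaleC)
  show of_real: "complex_of_real r *\<^sub>C f = r *\<^sub>R f" for r and f :: "'a \<Rightarrow>\<^sub>C 'b"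
    by (rule bcontfun_eqI) (simp add: scaleC_of_real)
  have le: "norm (c *\<^sub>C f) \<le> cmod c * norm f" for c and f :: "'a \<Rightarrow>\<^sub>C 'b"
    by (rule norm_bound) (simp add: norm_scaleC mult_left_mono norm_bounded)
  show "norm (c *\<^sub>C f) = cmod c * norm f"
  proof (cases "c = 0")
    case True
    then show ?thesis
      using of_real[of 0 f] by simp
  next
    case False
    have "f = inverse c *\<^sub>C c *\<^sub>C f"
      using False of_real[of 1 f] by (simp add: assoc)
    then have "norm f \<le> cmod (inverse c) * norm (c *\<^sub>C f)"
      using le by metis
    then have "cmod c * norm f \<le> norm (c *\<^sub>C f)"
      using False by (simp add: norm_inverse norm_divide field_simps)
    then show ?thesis
      using le[of c f] by simp
  qed
qed

end

definition norm_attainment_set :: "('k::topological_space \<Rightarrow>\<^sub>C 'y::real_normed_vector) \<Rightarrow> 'k set"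
  where "norm_attainment_set f = {t. norm (f t) = norm f}"

definition unit_scalars :: "'s::real_normed_field set"
  where "unit_scalars = {\<gamma>. norm \<gamma> = 1}"

(* The next two notions depend on the scalar field, so they take the scalar multiplication as
   argument s: scaleR over the reals, scaleC over the complex numbers. *)

definition bj_orthogonal ::
    "('s::real_normed_field \<Rightarrow> 'x \<Rightarrow> 'x) \<Rightarrow> 'x::real_normed_vector \<Rightarrow> 'x \<Rightarrow> bool"
  where "bj_orthogonal s x y \<longleftrightarrow> (\<forall>a. norm (x + s a y) \<ge> norm x)"

definition dir_orthogonal ::
    "('s::real_normed_field \<Rightarrow> 'x \<Rightarrow> 'x) \<Rightarrow> 's \<Rightarrow> 'x::real_normed_vector \<Rightarrow> 'x \<Rightarrow> bool"
  where "dir_orthogonal s \<gamma> x y \<longleftrightarrow> (\<forall>t::real. norm (x + s (of_real t * \<gamma>) y) \<ge> norm x)"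

end

(* Orthogonality over the scalar field amounts to real-linear orthogonality of f to mu g for every
   unimodular mu, so fix h = mu g. The points t at which s \<mapsto> norm (f t + s h t) stays above norm f for
   all s > 0 form the intersection of the sets {t. norm (f t + s h t) \<ge> norm f}; by convexity of the
   norm these decrease with s, so compactness yields such a point, and letting s tend to 0 puts it in
   the norm attainment set. The same holds for s < 0. Every t in the norm attainment set belongs to
   one of the two closed sets so obtained, hence connectedness produces a point in both. *)

theory Submission
  imports Defs
begin

text \<open>With \<open>q = r / s\<close>, the point \<open>x + r *\<^sub>R y\<close> is a convex
  combination of \<open>x\<close> and \<open>x + s *\<^sub>R y\<close> that gives positive weight to
  the latter. The bound \<open>c\<close> is kept apart from \<open>norm x\<close> because it later
  becomes \<open>norm f\<close>, which may exceed \<open>norm (f t)\<close>.\<close>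

lemma norm_add_scaleR_less_mono:
  fixes x y :: "'a::real_normed_vector"
  assumes "0 < r" "r \<le> s" "norm x \<le> c" "norm (x + s *\<^sub>R y) < c"
  shows "norm (x + r *\<^sub>R y) < c"
proof -
  define q where "q = r / s"
  have q: "0 < q" "q \<le> 1" "q * s = r"
    using assms by (auto simp: q_def)
  have "x + r *\<^sub>R y = (1 - q) *\<^sub>R x + q *\<^sub>R (x + s *\<^sub>R y)"
    by (simp add: algebra_simps flip: q(3))
  then have "norm (x + r *\<^sub>R y) \<le> (1 - q) * norm x + q * norm (x + s *\<^sub>R y)"
    using q norm_triangle_ineq[of "(1 - q) *\<^sub>R x" "q *\<^sub>R (x + s *\<^sub>R y)"] by simp
  also have "\<dots> < (1 - q) * c + q * c"
    using q assms by (intro add_le_less_mono mult_left_mono mult_strict_left_mono) auto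
  finally show ?thesis
    by (simp add: algebra_simps)
qed

text \<open>If the norm dropped on both sides, the preceding lemma would make it drop at a common
  distance \<open>r\<close> on both sides. But \<open>x\<close> is the midpoint of
  \<open>x + r *\<^sub>R y\<close> and \<open>x - r *\<^sub>R y\<close>, so one of these has norm at
  least \<open>norm x\<close>.\<close>

lemma norm_add_scaleR_ge_one_side:
  fixes x y :: "'a::real_normed_vector"
  shows "(\<forall>s>0. norm x \<le> norm (x + s *\<^sub>R y)) \<or> (\<forall>s>0. norm x \<le> norm (x + s *\<^sub>R - y))"
proof (rule ccontr)
  assume "\<not> ?thesis"
  then obtain a b where ab: "a > 0" "norm (x + a *\<^sub>R y) < norm x"
      "b > 0" "norm (x + b *\<^sub>R - y) < norm x"
    by (auto simp: not_le)
  define r where "r = min a b"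
  have "norm (x + r *\<^sub>R y) < norm x" "norm (x + r *\<^sub>R - y) < norm x"
    using ab by (auto simp: r_def intro: norm_add_scaleR_less_mono[where s = a]
      norm_add_scaleR_less_mono[where s = b and y = "- y", simplified])
  moreover have "2 *\<^sub>R x = (x + r *\<^sub>R y) + (x + r *\<^sub>R - y)"
    by (simp add: scaleR_2)
  then have "2 * norm x \<le> norm (x + r *\<^sub>R y) + norm (x + r *\<^sub>R - y)"
    using norm_triangle_ineq[of "x + r *\<^sub>R y" "x + r *\<^sub>R - y"]
    by (metis norm_scaleR abs_numeral)
  ultimately show False
    by linarith
qed

lemma norm_bcontfun_attained:
  fixes f :: "'k::topological_space \<Rightarrow>\<^sub>C 'y::real_normed_vector"
  assumes "compact (UNIV :: 'k set)"
  obtains t where "norm (f t) = norm f"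
proof -
  obtain t where "\<And>s. norm (f s) \<le> norm (f t)"
    using continuous_attains_sup[OF assms, of "\<lambda>t. norm (f t)"]
    by (auto intro!: continuous_intros)
  then have "norm f \<le> norm (f t)"
    by (rule norm_bound)
  then show thesis
    using norm_bounded[of f t] that by force
qed

lemma ex_norm_attainment_set_ge:
  fixes f h :: "'k::topological_space \<Rightarrow>\<^sub>C 'y::real_normed_vector"
  assumes "compact (UNIV :: 'k set)"
    and ge: "\<And>s. s > 0 \<Longrightarrow> norm f \<le> norm (f + s *\<^sub>R h)"
  shows "\<exists>t\<in>norm_attainment_set f. \<forall>s>0. norm f \<le> norm (f t + s *\<^sub>R h t)"
proof -
  define C where "C s = {t. norm f \<le> norm (f t + s *\<^sub>R h t)}" for s :: real
  have closed: "closed (C s)" for s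
    unfolding C_def by (auto intro!: closed_Collect_le continuous_intros)
  have mono: "C r \<subseteq> C s" if "0 < r" "r \<le> s" for r s
    using norm_add_scaleR_less_mono[OF that norm_bounded, of f] unfolding C_def
    by (force simp: not_le[symmetric])
  have nonempty: "C s \<noteq> {}" if s: "s > 0" for s
  proof -
    \<comment> \<open>A point where \<open>f + s *\<^sub>R h\<close> attains its own norm works,
      since that norm is at least \<open>norm f\<close>.\<close>
    obtain t where "norm ((f + s *\<^sub>R h) t) = norm (f + s *\<^sub>R h)"
      using norm_bcontfun_attained[OF assms(1)] by blast
    then have "t \<in> C s"
      using ge[OF s] by (simp add: C_def)
    then show ?thesis
      by blast
  qed
  have "UNIV \<inter> (\<Inter>s\<in>{0<..}. C s) \<noteq> {}"
  proof (rule compact_imp_fip_image[OF assms(1)])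
    fix I :: "real set"
    assume I: "finite I" "I \<subseteq> {0<..}"
    \<comment> \<open>Inserting 1 gives the minimum a meaning for empty \<open>I\<close> and keeps
      it positive. By monotonicity \<open>C r\<close> lies below all the finitely many sets.\<close>
    define r where "r = Min (insert 1 I)"
    have "r > 0"
      using I by (auto simp: r_def)
    then have "C r \<subseteq> (\<Inter>s\<in>I. C s)"
      using I by (intro INT_greatest mono) (auto simp: r_def)
    then show "UNIV \<inter> (\<Inter>s\<in>I. C s) \<noteq> {}"
      using nonempty[OF \<open>r > 0\<close>] by blast
  qed (rule closed)
  then obtain t where t: "\<And>s. s > 0 \<Longrightarrow> norm f \<le> norm (f t + s *\<^sub>R h t)"
    by (auto simp: C_def)
  \<comment> \<open>The limit is taken from the right because the lower bound is known for positive
    \<open>s\<close> only.\<close>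
  have "((\<lambda>s. norm (f t + s *\<^sub>R h t)) \<longlongrightarrow> norm (f t + 0 *\<^sub>R h t)) (at_right 0)"
    by (intro tendsto_intros)
  then have "norm f \<le> norm (f t + 0 *\<^sub>R h t)"
    by (rule tendsto_lowerbound) (auto simp: eventually_at_filter t)
  then have "t \<in> norm_attainment_set f"
    using norm_bounded[of f t] by (simp add: norm_attainment_set_def)
  then show ?thesis
    using t by blast
qed

text \<open>Only real multiples of \<open>h\<close> occur, so that one statement serves both scalar
  fields: \<open>h\<close> becomes \<open>g\<close> in the real case and
  \<open>\<mu> *\<^sub>C g\<close> in the complex one.\<close>

lemma real_orthogonal_iff_ex:
  fixes f h :: "'k::topological_space \<Rightarrow>\<^sub>C 'y::real_normed_vector"
  assumes "compact (UNIV :: 'k set)" and conn: "connected (norm_attainment_set f)"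
  shows "(\<forall>s. norm f \<le> norm (f + s *\<^sub>R h)) \<longleftrightarrow>
    (\<exists>t\<in>norm_attainment_set f. \<forall>s. norm (f t) \<le> norm (f t + s *\<^sub>R h t))"
proof
  assume "\<exists>t\<in>norm_attainment_set f. \<forall>s. norm (f t) \<le> norm (f t + s *\<^sub>R h t)"
  then obtain t where t: "norm (f t) = norm f" "\<And>s. norm (f t) \<le> norm (f t + s *\<^sub>R h t)"
    by (auto simp: norm_attainment_set_def)
  show "\<forall>s. norm f \<le> norm (f + s *\<^sub>R h)"
  proof
    fix s
    show "norm f \<le> norm (f + s *\<^sub>R h)"
      using t(1) t(2)[of s] norm_bounded[of "f + s *\<^sub>R h" t] by simp
  qed
next
  assume ge: "\<forall>s. norm f \<le> norm (f + s *\<^sub>R h)"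
  let ?M = "norm_attainment_set f"
  define A where "A k = {t. \<forall>s>0. norm f \<le> norm (f t + s *\<^sub>R k t)}" for k :: "'k \<Rightarrow>\<^sub>C 'y"
  have closed: "closed (A k)" for k
    unfolding A_def
    by (auto intro!: closed_Collect_all closed_Collect_imp closed_Collect_le continuous_intros)
  \<comment> \<open>On \<open>?M\<close> the threshold \<open>norm f\<close> equals
    \<open>norm (f t)\<close>, so the one-sided alternative applies pointwise.\<close>
  have "?M \<subseteq> A h \<union> A (- h)"
  proof
    fix t
    assume "t \<in> ?M"
    then show "t \<in> A h \<union> A (- h)"
      using norm_add_scaleR_ge_one_side[of "f t" "h t"] by (auto simp: A_def norm_attainment_set_def)
  qed
  moreover have "A h \<inter> ?M \<noteq> {}"
    using ex_norm_attainment_set_ge[OF assms(1), of f h] ge by (auto simp: A_def)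
  moreover have "norm f \<le> norm (f + s *\<^sub>R - h)" for s
    using ge[rule_format, of "- s"] by simp
  then have "A (- h) \<inter> ?M \<noteq> {}"
    using ex_norm_attainment_set_ge[OF assms(1), of f "- h"] by (auto simp: A_def)
  ultimately have "A h \<inter> A (- h) \<inter> ?M \<noteq> {}"
    using connected_closedD[OF conn _ _ closed closed] by blast
  then obtain t where t: "t \<in> ?M" "t \<in> A h" "t \<in> A (- h)"
    by blast
  have "norm (f t) \<le> norm (f t + s *\<^sub>R h t)" for s
  proof (cases s "0::real" rule: linorder_cases)
    case less
    then have "norm f \<le> norm (f t + (- s) *\<^sub>R (- h) t)"
      using t(3) unfolding A_def by (simp only: mem_Collect_eq neg_0_less_iff_less)
    then show ?thesis
      using t(1) by (simp add: norm_attainment_set_def)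
  qed (use t in \<open>auto simp: A_def norm_attainment_set_def\<close>)
  then show "\<exists>t\<in>?M. \<forall>s. norm (f t) \<le> norm (f t + s *\<^sub>R h t)"
    using t(1) by blast
qed

text \<open>Polar decomposition of scalars: every \<open>a\<close> is its modulus times a unimodular
  factor.\<close>

lemma bj_orthogonal_iff_dir_orthogonal:
  fixes s :: "'s::real_normed_field \<Rightarrow> 'x \<Rightarrow> 'x::real_normed_vector"
  shows "bj_orthogonal s x y \<longleftrightarrow> (\<forall>\<mu>\<in>unit_scalars. dir_orthogonal s \<mu> x y)"
proof
  assume R: "\<forall>\<mu>\<in>unit_scalars. dir_orthogonal s \<mu> x y"
  show "bj_orthogonal s x y"
    unfolding bj_orthogonal_def
  proof
    fix a :: 's
    obtain \<mu> where "\<mu> \<in> unit_scalars" "of_real (norm a) * \<mu> = a"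
    proof (cases "a = 0")
      case True
      \<comment> \<open>Zero has no phase of its own, so 1 is chosen.\<close>
      then show thesis
        using that[of 1] by (simp add: unit_scalars_def)
    next
      case False
      then show thesis
        using that[of "a / of_real (norm a)"] by (simp add: unit_scalars_def norm_divide)
    qed
    then show "norm x \<le> norm (x + s a y)"
      using R by (metis dir_orthogonal_def)
  qed
qed (simp add: bj_orthogonal_def dir_orthogonal_def)

lemma scaleC_of_real_mult: "(complex_of_real r * \<mu>) *\<^sub>C x = r *\<^sub>R \<mu> *\<^sub>C x"
  by (metis scaleC_of_real scaleC_scaleC)

lemma dir_orthogonal_scaleC_iff_ex:
  fixes f g :: "'k::topological_space \<Rightarrow>\<^sub>C 'y::complex_normed_vector"
  assumes "compact (UNIV :: 'k set)" "connected (norm_attainment_set f)"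
  shows "dir_orthogonal scaleC \<mu> f g \<longleftrightarrow>
    (\<exists>t\<in>norm_attainment_set f. dir_orthogonal scaleC \<mu> (f t) (g t))"
  using real_orthogonal_iff_ex[OF assms, of "\<mu> *\<^sub>C g"]
  by (simp add: dir_orthogonal_def scaleC_of_real_mult)

lemma bj_orthogonal_scaleR_iff_ex:
  fixes f g :: "'k::topological_space \<Rightarrow>\<^sub>C 'y::real_normed_vector"
  assumes "compact (UNIV :: 'k set)" "connected (norm_attainment_set f)"
  shows "bj_orthogonal scaleR f g \<longleftrightarrow>
    (\<exists>t\<in>norm_attainment_set f. bj_orthogonal scaleR (f t) (g t))"
  using real_orthogonal_iff_ex[OF assms, of g] by (simp add: bj_orthogonal_def)

text \<open>Every real number is a real multiple of the nonzero \<open>\<mu>\<close>, so over the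
  reals all directions give the same condition.\<close>

lemma dir_orthogonal_scaleR:
  assumes "\<mu> \<in> unit_scalars"
  shows "dir_orthogonal scaleR \<mu> x y \<longleftrightarrow> bj_orthogonal scaleR x y"
proof
  assume R: "dir_orthogonal scaleR \<mu> x y"
  have "\<mu> \<noteq> 0"
    using assms by (auto simp: unit_scalars_def)
  then have "a = of_real (a / \<mu>) * \<mu>" for a
    by simp
  then show "bj_orthogonal scaleR x y"
    using R unfolding bj_orthogonal_def dir_orthogonal_def by metis
qed (simp add: bj_orthogonal_def dir_orthogonal_def)

theorem theorem4p3:
  fixes f g :: "'k::t2_space \<Rightarrow>\<^sub>C 'y::banach"
    and u v :: "'k \<Rightarrow>\<^sub>C 'z::complex_banach"
  assumes "compact (UNIV :: 'k set)"
  shows "(connected (norm_attainment_set f) \<longrightarrow>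
           (bj_orthogonal scaleR f g \<longleftrightarrow>
             (\<forall>\<mu>\<in>unit_scalars. \<exists>t\<in>norm_attainment_set f. dir_orthogonal scaleR \<mu> (f t) (g t))) \<and>
           (bj_orthogonal scaleR f g \<longleftrightarrow>
             (\<exists>t\<in>norm_attainment_set f. bj_orthogonal scaleR (f t) (g t)))) \<and>
         (connected (norm_attainment_set u) \<longrightarrow>
           (bj_orthogonal scaleC u v \<longleftrightarrow>
             (\<forall>\<mu>\<in>unit_scalars. \<exists>t\<in>norm_attainment_set u. dir_orthogonal scaleC \<mu> (u t) (v t))))"
proof (intro conjI impI)
  assume conn: "connected (norm_attainment_set f)"
  show "bj_orthogonal scaleR f g \<longleftrightarrow>
      (\<exists>t\<in>norm_attainment_set f. bj_orthogonal scaleR (f t) (g t))"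
    by (rule bj_orthogonal_scaleR_iff_ex[OF assms conn])
  \<comment> \<open>Since the direction is immaterial, one \<open>t\<close> serves every
    \<open>\<mu>\<close>. Conversely, the instance \<open>\<mu> = 1\<close> already provides a
    suitable \<open>t\<close>.\<close>
  then show "bj_orthogonal scaleR f g \<longleftrightarrow>
      (\<forall>\<mu>\<in>unit_scalars. \<exists>t\<in>norm_attainment_set f. dir_orthogonal scaleR \<mu> (f t) (g t))"
    by (auto simp: dir_orthogonal_scaleR unit_scalars_def intro: exI[of _ 1])
next
  assume "connected (norm_attainment_set u)"
  then show "bj_orthogonal scaleC u v \<longleftrightarrow>
      (\<forall>\<mu>\<in>unit_scalars. \<exists>t\<in>norm_attainment_set u. dir_orthogonal scaleC \<mu> (u t) (v t))"
    \<comment> \<open>Orthogonality of \<open>u\<close> and \<open>v\<close> is split into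
      directions first, and each direction is then localized separately; hence \<open>t\<close> may
      vary with \<open>\<mu>\<close>.\<close>
    by (simp add: bj_orthogonal_iff_dir_orthogonal dir_orthogonal_scaleC_iff_ex[OF assms])
qed

end
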